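(* Let $n\ge 1$, $\sigma>0$, $\gamma>0$ and $\rho\in(0,1)$. Let $A,Q$ be real symmetric $n\times n$ matrices, $B$ a real skew-symmetric $n\times n$ matrix, $b\in\mathbb{R}^n$ and $y,z\in\mathbb{R}$ satisfy all of the following: $$\sum_{k,l=1}^n A_{kl}+\mathrm{Tr}(Q)-2z\sqrt{\log\rho^{-1}}+2y\log\rho\ \ge\ \gamma,$$ $$\sqrt{\|Q\|_F^2+\tfrac12\|b\|_2^2}\ \le\ z,\qquad yI+Q\succeq 0,\qquad Q=\sigma^2L(A),\qquad b=\sigma f(B),\qquad y\ge 0.$$ Let $M=A+iB$ and let $\xi\sim\mathcal{N}(0,I)$ be a standard Gaussian random vector in $\mathbb{R}^n$. Then $$\Pr\left(\sum_{k,l=1}^n M_{kl}+\sigma^2\,\xi^TL(A)\,\xi+\sigma f(B)^T\xi\ \ge\ \gamma\right)\ \ge\ 1-\rho .$$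
   Context: The linear map $L:\mathbb{R}^{n\times n}\to\mathbb{R}^{n\times n}$ is defined by $(L(A))_{kk}=A_{kk}-\sum_{j=1}^n A_{kj}$ and $(L(A))_{kl}=A_{kl}$ for $k\ne l$. The linear map $f:\mathbb{R}^{n\times n}\to\mathbb{R}^n$ is defined by $(f(A))_k=2\sum_{j=1}^n A_{kj}$. $\|\cdot\|_F$ is the Frobenius norm, $\|\cdot\|_2$ the Euclidean norm, $\succeq 0$ means positive semidefinite, $\log$ is the natural logarithm, and $i$ in $A+iB$ is the imaginary unit. Since $B$ is skew-symmetric, $\sum_{k,l}M_{kl}=\sum_{k,l}A_{kl}$ is real. *)

theory Defs
  imports "HOL-Probability.Probability"
begin

definition L_map :: "real^'n^'n \<Rightarrow> real^'n^'n" where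
  "L_map A = (\<chi> k l. if k = l then A $ k $ k - (\<Sum>j\<in>UNIV. A $ k $ j) else A $ k $ l)"

definition f_map :: "real^'n^'n \<Rightarrow> real^'n" where
  "f_map A = (\<chi> k. 2 * (\<Sum>j\<in>UNIV. A $ k $ j))"

definition frobenius_norm :: "real^'n^'n \<Rightarrow> real" where
  "frobenius_norm A = sqrt (\<Sum>k\<in>UNIV. \<Sum>l\<in>UNIV. (A $ k $ l)\<^sup>2)"

lemma frobenius_norm_eq_norm: "frobenius_norm A = norm A"
  by (simp add: frobenius_norm_def norm_vec_def L2_set_def sum_nonneg)

definition symmetric_mat :: "real^'n^'n \<Rightarrow> bool" where
  "symmetric_mat A \<longleftrightarrow> transpose A = A"

definition skew_symmetric_mat :: "real^'n^'n \<Rightarrow> bool" where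
  "skew_symmetric_mat B \<longleftrightarrow> transpose B = - B"

definition pos_semidef :: "real^'n^'n \<Rightarrow> bool" where
  "pos_semidef A \<longleftrightarrow> symmetric_mat A \<and> (\<forall>x. 0 \<le> x \<bullet> (A *v x))"

definition complex_mat :: "real^'n^'n \<Rightarrow> real^'n^'n \<Rightarrow> complex^'n^'n" where
  "complex_mat A B = (\<chi> k l. of_real (A $ k $ l) + \<i> * of_real (B $ k $ l))"

(* Justifies comparing the real part of the entry sum of A + iB with a real number. *)
lemma sum_complex_mat_real:
  fixes A B :: "real^'n^'n"
  assumes "skew_symmetric_mat B"
  shows "(\<Sum>k\<in>UNIV. \<Sum>l\<in>UNIV. complex_mat A B $ k $ l)
    = of_real (\<Sum>k\<in>UNIV. \<Sum>l\<in>UNIV. A $ k $ l)"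
proof -
  have neg: "B $ l $ k = - B $ k $ l" for k l
  proof -
    have "transpose B $ k $ l = (- B) $ k $ l"
      using assms by (simp only: skew_symmetric_mat_def)
    then show ?thesis
      unfolding transpose_def vector_uminus_component by (simp only: vec_lambda_beta)
  qed
  have "(\<Sum>k\<in>UNIV. \<Sum>l\<in>UNIV. B $ k $ l) = (\<Sum>l\<in>UNIV. \<Sum>k\<in>UNIV. B $ k $ l)"
    by (rule sum.swap)
  also have "\<dots> = - (\<Sum>k\<in>UNIV. \<Sum>l\<in>UNIV. B $ k $ l)"
    by (subst neg) (simp add: sum_negf)
  finally have "(\<Sum>k\<in>UNIV. \<Sum>l\<in>UNIV. B $ k $ l) = 0" by simp
  then show ?thesis
    by (simp add: complex_eq_iff complex_mat_def)
qed

definition std_gaussian_density :: "real^'n \<Rightarrow> real" where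
  "std_gaussian_density x = exp (- (norm x)\<^sup>2 / 2) / sqrt (2 * pi) ^ CARD('n)"

lemma std_gaussian_density_eq_prod:
  "std_gaussian_density x = (\<Prod>i\<in>UNIV. std_normal_density (x $ i))"
proof -
  have "- (norm x)\<^sup>2 / 2 = (\<Sum>i\<in>UNIV. - (x $ i)\<^sup>2 / 2)"
    by (simp add: norm_vec_def L2_set_def sum_nonneg sum_negf sum_divide_distrib)
  then have "exp (- (norm x)\<^sup>2 / 2) = (\<Prod>i\<in>UNIV. exp (- (x $ i)\<^sup>2 / 2))"
    by (simp only: exp_sum[OF finite])
  then show ?thesis
    by (simp add: std_gaussian_density_def std_normal_density_def prod.distrib prod_dividef
        power_one_over)
qed

definition std_gaussian_vector :: "'a measure \<Rightarrow> ('a \<Rightarrow> real^'n) \<Rightarrow> bool" where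
  "std_gaussian_vector P \<xi> \<longleftrightarrow>
     distributed P lborel \<xi> (\<lambda>x. ennreal (std_gaussian_density x))"

end

theory Submission
  imports Defs
begin

text \<open>
  Put \<open>s = - ln \<rho>\<close>. The claim is a lower-tail Bernstein inequality for the Gaussian quadratic form
  \<open>X = \<xi> \<bullet> Q \<xi> + b \<bullet> \<xi>\<close>: it falls below \<open>trace Q - 2 z sqrt s - 2 y s\<close> with probability at most
  \<open>exp (- s)\<close>. Diagonalising \<open>Q\<close> orthogonally, with eigenvalues \<open>d\<^sub>i \<ge> - y\<close> and \<open>e\<^sub>i\<close> the coordinates of
  \<open>b\<close> in the eigenbasis, rotation invariance factors the Laplace transform of \<open>X\<close> at \<open>t\<close> into
  one-dimensional Gaussian integrals
  \<open>(1 + 2 t d\<^sub>i) powr (- 1/2) * exp (t\<^sup>2 e\<^sub>i\<^sup>2 / (2 (1 + 2 t d\<^sub>i)))\<close>. The inequality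
  \<open>ln (1 + w) \<ge> w - w\<^sup>2 / (2 \<delta>)\<close> for \<open>1 + w \<ge> \<delta> = 1 - 2 t y\<close> bounds their product by
  \<open>exp (- t trace Q + t\<^sup>2 z\<^sup>2 / \<delta>)\<close>, and Chernoff's bound is applied with
  \<open>t = sqrt s / (z + 2 y sqrt s)\<close>.
\<close>

section \<open>Spectral theorem for real symmetric matrices\<close>

text \<open>The quadratic form \<open>x \<bullet> f x\<close> attains its maximum on the compact
  unit sphere of \<open>S\<close>. A first-order variation shows that a maximiser is an eigenvector,
  with the maximum as eigenvalue.\<close>

lemma selfadjoint_eigenvector:
  fixes f :: "'a::euclidean_space \<Rightarrow> 'a"
  assumes lin: "linear f" and sa: "\<And>x y. f x \<bullet> y = x \<bullet> f y"
    and S: "subspace S" and inv: "f ` S \<subseteq> S" and ne: "S \<noteq> {0}"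
  obtains u c where "u \<in> S" "norm u = 1" "f u = c *\<^sub>R u"
proof -
  interpret linear f by fact
  obtain w where w: "w \<in> S" "w \<noteq> 0"
    using ne S subspace_0 by blast
  let ?K = "S \<inter> sphere 0 1"
  have "compact ?K"
    using closed_subspace[OF S] by (simp add: compact_Int_closed Int_commute closed_Int_compact)
  moreover have "sgn w \<in> ?K"
    using w S by (simp add: sgn_div_norm subspace_scale)
  moreover have "continuous_on ?K (\<lambda>x. x \<bullet> f x)"
    using lin by (intro continuous_intros linear_continuous_on linear_conv_bounded_linear[THEN iffD1])
  ultimately obtain u where u: "u \<in> ?K" and max: "\<And>x. x \<in> ?K \<Longrightarrow> x \<bullet> f x \<le> u \<bullet> f u"
    using continuous_attains_sup[of ?K "\<lambda>x. x \<bullet> f x"] by blast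
  define c where "c = u \<bullet> f u"
  have uu: "u \<bullet> u = 1" and uS: "u \<in> S"
    using u by (auto simp: dot_square_norm)
  \<comment> \<open>Both sides are homogeneous of degree two, so the maximality on the unit sphere
    extends to all of \<open>S\<close>.\<close>
  have le: "x \<bullet> f x \<le> c * (x \<bullet> x)" if "x \<in> S" for x
  proof (cases "x = 0")
    case False
    have "sgn x \<bullet> f (sgn x) \<le> c"
      unfolding c_def using that False S by (intro max) (simp add: sgn_div_norm subspace_scale)
    then have "x \<bullet> f x / (norm x)\<^sup>2 \<le> c"
      by (simp add: sgn_div_norm scale power2_eq_square divide_inverse mult_ac)
    then show ?thesis
      using False by (simp add: divide_le_eq power2_norm_eq_inner)
  qed (simp add: zero)
  \<comment> \<open>\<open>v\<close> is the residual of the eigenvalue equation, so the goal is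
    \<open>v = 0\<close>. It lies in \<open>S\<close> by invariance, hence perturbing
    \<open>u\<close> along \<open>v\<close> stays in \<open>S\<close>, and it is orthogonal to
    \<open>u\<close>.\<close>
  define v where "v = f u - c *\<^sub>R u"
  have vS: "v \<in> S"
    using inv uS S unfolding v_def by (auto intro!: subspace_diff subspace_scale)
  have uv: "u \<bullet> v = 0"
    by (simp add: v_def inner_diff_right uu c_def)
  then have vfu: "v \<bullet> f u = v \<bullet> v"
    by (simp add: v_def inner_diff_right inner_diff_left uu inner_commute)
  define p where "p = v \<bullet> v"
  define q where "q = c * (v \<bullet> v) - v \<bullet> f v"
  \<comment> \<open>Perturbing the maximiser \<open>u\<close> of the Rayleigh quotient in the direction \<open>v\<close> has first-order effect
    \<open>2 * s * p\<close>, which must vanish.\<close>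
  have quad: "2 * s * p \<le> s\<^sup>2 * q" for s
  proof -
    have "u + s *\<^sub>R v \<in> S"
      using uS vS S by (intro subspace_add subspace_scale)
    from le[OF this] have "(u + s *\<^sub>R v) \<bullet> f (u + s *\<^sub>R v) \<le> c * ((u + s *\<^sub>R v) \<bullet> (u + s *\<^sub>R v))" .
    moreover have "(u + s *\<^sub>R v) \<bullet> (u + s *\<^sub>R v) = 1 + s\<^sup>2 * p"
      using uv uu by (simp add: inner_add_left inner_add_right inner_commute[of v u] p_def power2_eq_square)
    moreover have "u \<bullet> f v = p"
      using sa[of u v] vfu by (simp add: p_def inner_commute)
    then have "(u + s *\<^sub>R v) \<bullet> f (u + s *\<^sub>R v) = c + 2 * s * p + s\<^sup>2 * (v \<bullet> f v)"
      using vfu by (simp add: add scale inner_add_left inner_add_right c_def p_def power2_eq_square distrib_left)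
    ultimately show ?thesis
      by (simp add: q_def p_def right_diff_distrib distrib_left mult.left_commute)
  qed
  have "p = 0"
  proof (rule ccontr)
    assume "p \<noteq> 0"
    then have "p > 0" by (simp add: p_def)
    \<comment> \<open>Chosen small enough that \<open>s * q \<le> p\<close>, which contradicts
      \<open>quad\<close> because \<open>2 * s * p\<close> would be at most \<open>s * p\<close>.
      The added 1 keeps the denominator positive when \<open>q = 0\<close>.\<close>
    define s where "s = p / (\<bar>q\<bar> + 1)"
    have "s > 0" using \<open>p > 0\<close> by (simp add: s_def add_nonneg_pos)
    have "s * q \<le> s * (\<bar>q\<bar> + 1)"
      using \<open>s > 0\<close> by (intro mult_left_mono) auto
    also have "\<dots> = p" by (simp add: s_def add_nonneg_pos[THEN less_imp_neq, symmetric])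
    finally have "s * (s * q) \<le> s * p" using \<open>s > 0\<close> by simp
    moreover have "s * p > 0" using \<open>s > 0\<close> \<open>p > 0\<close> by simp
    ultimately show False using quad[of s] by (simp add: power2_eq_square mult_ac)
  qed
  then have "f u = c *\<^sub>R u"
    by (simp add: p_def v_def)
  then show thesis
    using that u by auto
qed

text \<open>Induction on the dimension: split off one unit eigenvector and continue in its
  orthogonal complement within \<open>S\<close>.\<close>

lemma selfadjoint_orthonormal_eigenbasis:
  fixes f :: "'a::euclidean_space \<Rightarrow> 'a"
  assumes lin: "linear f" and sa: "\<And>x y. f x \<bullet> y = x \<bullet> f y"
    and "subspace S" "f ` S \<subseteq> S"
  shows "\<exists>B. finite B \<and> B \<subseteq> S \<and> pairwise orthogonal B \<and> card B = dim S \<and>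
    (\<forall>u\<in>B. norm u = 1 \<and> (\<exists>c. f u = c *\<^sub>R u))"
  using assms(3,4)
proof (induction "dim S" arbitrary: S)
  case 0
  then show ?case by (intro exI[of _ "{}"]) auto
next
  case (Suc n)
  have "S \<noteq> {0}"
    using Suc.hyps(2) by force
  then obtain u c where u: "u \<in> S" "norm u = 1" "f u = c *\<^sub>R u"
    using selfadjoint_eigenvector[OF lin sa Suc.prems] by metis
  have u0: "u \<noteq> 0" using u by auto
  define S' where "S' = {x \<in> S. u \<bullet> x = 0}"
  have sub: "subspace S'"
    using Suc.prems(1) subspace_hyperplane[of u] unfolding S'_def
    by (simp add: Collect_conj_eq subspace_inter)
  have eq: "{y \<in> S. \<forall>x\<in>span {u}. orthogonal x y} = S'"
    by (auto simp: S'_def span_singleton orthogonal_def)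
  have "dim S' + dim (span {u}) = dim S"
    using dim_subspace_orthogonal_to_vectors[of "span {u}" S] u Suc.prems(1)
    unfolding eq by (simp add: span_minimal)
  then have dim: "dim S' = n"
    using Suc.hyps(2) u0 by simp
  \<comment> \<open>Self-adjointness moves \<open>f\<close> onto the eigenvector:
    \<open>u \<bullet> f x = f u \<bullet> x = c * (u \<bullet> x) = 0\<close>.\<close>
  have "f ` S' \<subseteq> S'"
    using Suc.prems(2) u by (auto simp: S'_def sa[symmetric])
  then obtain B where B: "finite B" "B \<subseteq> S'" "pairwise orthogonal B" "card B = n"
    "\<forall>u\<in>B. norm u = 1 \<and> (\<exists>c. f u = c *\<^sub>R u)"
    using Suc.hyps(1)[of S'] dim sub by metis
  have "u \<notin> B"
    using B(2) u0 by (auto simp: S'_def)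
  then show ?case
    using B u Suc.hyps(2)
    by (intro exI[of _ "insert u B"])
       (auto simp: S'_def pairwise_insert orthogonal_def inner_commute)
qed

text \<open>The columns of \<open>U\<close> are the orthonormal eigenvectors. There are exactly
  \<open>CARD('n)\<close> of them, so they can be indexed by \<open>'n\<close> itself.\<close>

lemma symmetric_mat_orthogonal_diagonalization:
  fixes Q :: "real^'n^'n"
  assumes "symmetric_mat Q"
  obtains U :: "real^'n^'n" and d :: "'n \<Rightarrow> real" where "orthogonal_matrix U"
    "Q ** U = U ** (\<chi> i j. if i = j then d i else 0)"
proof -
  have tr: "transpose Q = Q"
    using assms by (simp add: symmetric_mat_def)
  have "(Q *v x) \<bullet> y = x \<bullet> (Q *v y)" for x y
    by (metis dot_lmul_matrix tr vector_transpose_matrix)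
  then obtain B where B: "finite B" "pairwise orthogonal B" "card B = CARD('n)"
    "\<forall>u\<in>B. norm u = 1 \<and> (\<exists>c. Q *v u = c *\<^sub>R u)"
    using selfadjoint_orthonormal_eigenbasis[of "(*v) Q" UNIV] by (auto simp: dim_UNIV)
  then obtain g where g: "bij_betw g (UNIV::'n set) B"
    by (metis finite_class.finite_UNIV finite_same_card_bij)
  have "\<forall>i. \<exists>c. Q *v g i = c *\<^sub>R g i"
    using B(4) g by (auto simp: bij_betw_def)
  then obtain d where d: "\<And>i. Q *v g i = d i *\<^sub>R g i" by metis
  define U :: "real^'n^'n" where "U = (\<chi> i j. g j $ i)"
  show thesis
  proof
    show "orthogonal_matrix U"
      using B(2,4) g
      by (simp add: U_def orthogonal_matrix_orthonormal_columns column_def pairwise_def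
          bij_betw_def inj_on_def) blast
    show "Q ** U = U ** (\<chi> i j. if i = j then d i else 0)"
    proof -
      have "(Q ** U) $ i $ j = (Q *v g j) $ i" for i j
        by (simp add: U_def matrix_matrix_mult_def matrix_vector_mult_def)
      then show ?thesis
        by (simp add: d vec_eq_iff U_def matrix_matrix_mult_def mult.commute if_distrib cong: if_cong)
    qed
  qed
qed

section \<open>Lebesgue integrals under translations and rotations, and of products\<close>

lemma nn_integral_lborel_translate:
  fixes f :: "'a::euclidean_space \<Rightarrow> ennreal"
  assumes [measurable]: "f \<in> borel_measurable borel"
  shows "(\<integral>\<^sup>+x. f (a + x) \<partial>lborel) = (\<integral>\<^sup>+x. f x \<partial>lborel)"
  by (subst lborel_distr_plus[of a, symmetric]) (simp add: nn_integral_distr)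

text \<open>The library's \<open>measure_orthogonal_image\<close> needs a well-ordered index type. Here the integral of
  \<open>f (T x) * I (y - T x)\<close> over both variables, with \<open>I\<close> the indicator of the unit ball, is computed in
  both orders: translation invariance and \<open>T\<close>-invariance of the ball give the two sides times the
  volume of the ball.\<close>
lemma nn_integral_lborel_orthogonal_transformation:
  fixes f :: "'a::euclidean_space \<Rightarrow> ennreal" and T :: "'a \<Rightarrow> 'a"
  assumes T: "orthogonal_transformation T" and f[measurable]: "f \<in> borel_measurable borel"
  shows "(\<integral>\<^sup>+x. f (T x) \<partial>lborel) = (\<integral>\<^sup>+x. f x \<partial>lborel)"
proof -
  interpret linear T
    using T by (rule orthogonal_transformation_linear)
  have [measurable]: "T \<in> borel_measurable borel"
    using linear_axioms
    by (intro borel_measurable_continuous_onI linear_continuous_on linear_conv_bounded_linear[THEN iffD1])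
  define I :: "'a \<Rightarrow> ennreal" where "I = indicator (ball 0 1)"
  have [measurable]: "I \<in> borel_measurable borel" unfolding I_def by (intro borel_measurable_indicator borel_open open_ball)
  define V where "V = (\<integral>\<^sup>+x. I x \<partial>lborel)"
  have V: "V = emeasure lborel (ball (0::'a) 1)"
    by (simp add: V_def I_def)
  have I: "I (- T x) = I x" for x
    using T by (simp add: I_def indicator_def orthogonal_transformation_norm)
  have "(\<integral>\<^sup>+x. f (T x) \<partial>lborel) * V = (\<integral>\<^sup>+x. f (T x) * (\<integral>\<^sup>+y. I (- T x + y) \<partial>lborel) \<partial>lborel)"
    unfolding V_def by (subst nn_integral_lborel_translate) (simp_all add: nn_integral_multc)
  also have "\<dots> = (\<integral>\<^sup>+x. (\<integral>\<^sup>+y. f (T x) * I (- T x + y) \<partial>lborel) \<partial>lborel)"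
    by (simp add: nn_integral_cmult)
  also have "\<dots> = (\<integral>\<^sup>+y. (\<integral>\<^sup>+x. f (T x) * I (- T x + y) \<partial>lborel) \<partial>lborel)"
    by (rule lborel_pair.Fubini') simp
  also have "\<dots> = (\<integral>\<^sup>+y. (\<integral>\<^sup>+x. f (y + T x) * I x \<partial>lborel) \<partial>lborel)"
  proof (rule nn_integral_cong)
    fix y
    \<comment> \<open>Since \<open>T\<close> is onto, the shift of \<open>T x\<close> by
      \<open>y\<close> comes from shifting \<open>x\<close> by \<open>a\<close>; this turns
      \<open>- T x + y\<close> into \<open>- T x\<close>, and \<open>I\<close> is invariant under
      \<open>x \<mapsto> - T x\<close>.\<close>
    obtain a where a: "y = T a"
      using orthogonal_transformation_surj[OF T] by (metis surjD)
    show "(\<integral>\<^sup>+x. f (T x) * I (- T x + y) \<partial>lborel) = (\<integral>\<^sup>+x. f (y + T x) * I x \<partial>lborel)"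
      by (subst nn_integral_lborel_translate[of _ a, symmetric]) (simp_all add: a add I)
  qed
  also have "\<dots> = (\<integral>\<^sup>+x. (\<integral>\<^sup>+y. f (y + T x) * I x \<partial>lborel) \<partial>lborel)"
    by (rule lborel_pair.Fubini') simp
  also have "\<dots> = (\<integral>\<^sup>+x. f x \<partial>lborel) * V"
    using nn_integral_lborel_translate[of f]
    by (simp add: nn_integral_multc nn_integral_cmult V_def add.commute[of _ "T _"])
  finally have "V * (\<integral>\<^sup>+x. f (T x) \<partial>lborel) = V * (\<integral>\<^sup>+x. f x \<partial>lborel)"
    by (simp add: mult.commute)
  moreover have "V \<noteq> 0" "V \<noteq> \<infinity>"
    unfolding V using less_imp_neq[OF unit_ball_vol_pos[of "real DIM('a)"]] by (simp_all add: emeasure_ball)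
  ultimately show ?thesis
    by (simp add: ennreal_mult_cancel_left)
qed

lemma nn_integral_lborel_vec_prod:
  fixes f :: "'n::finite \<Rightarrow> real \<Rightarrow> ennreal"
  assumes [measurable]: "\<And>i. f i \<in> borel_measurable borel"
  shows "(\<integral>\<^sup>+x. (\<Prod>i\<in>UNIV. f i (x $ i)) \<partial>lborel) = (\<Prod>i\<in>UNIV. \<integral>\<^sup>+x. f i x \<partial>lborel)"
proof -
  \<comment> \<open>The product formula for \<open>lborel\<close> runs over \<open>Basis\<close>;
    \<open>ix\<close> recovers the coordinate index from a basis vector, so that the factors can be
    reindexed by \<open>'n\<close>.\<close>
  define ix :: "real^'n \<Rightarrow> 'n" where "ix = (\<lambda>b. THE i. b = axis i 1)"
  have ix [simp]: "ix (axis i 1) = i" for i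
    by (simp add: ix_def axis_eq_axis)
  have B: "Basis = range (\<lambda>i::'n. axis i (1::real))"
    by (auto simp: Basis_vec_def)
  have *: "(\<Prod>b\<in>Basis. h b) = (\<Prod>i\<in>UNIV. h (axis i 1))" for h :: "real^'n \<Rightarrow> ennreal"
    unfolding B by (subst prod.reindex) (auto simp: inj_on_def axis_eq_axis)
  show ?thesis
    using nn_integral_lborel_prod[of "\<lambda>b. f (ix b)"] by (simp add: * inner_axis)
qed

section \<open>One-dimensional Gaussian integrals and their estimates\<close>

text \<open>Completing the square, with \<open>h = 1 + 2 * a\<close>: the integrand is a constant
  times the normal density of mean \<open>- c / h\<close> and variance \<open>1 / h\<close>, which
  integrates to one.\<close>

lemma nn_integral_std_normal_exp_quadratic:
  assumes "1 + 2 * a > 0"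
  shows "(\<integral>\<^sup>+x. ennreal (std_normal_density x * exp (- (a * x\<^sup>2 + c * x))) \<partial>lborel)
    = ennreal (exp (c\<^sup>2 / (2 * (1 + 2 * a))) / sqrt (1 + 2 * a))"
proof -
  define h where "h = 1 + 2 * a"
  have h: "h > 0" and a: "a = (h - 1) / 2" using assms by (auto simp: h_def)
  define K where "K = exp (c\<^sup>2 / (2 * h)) / sqrt h"
  have K: "0 \<le> K" using h by (simp add: K_def)
  have eq: "std_normal_density x * exp (- (a * x\<^sup>2 + c * x)) = K * normal_density (- c / h) (1 / sqrt h) x" for x
  proof -
    have "- x\<^sup>2 / 2 - (a * x\<^sup>2 + c * x) = c\<^sup>2 / (2 * h) - (x - (- c / h))\<^sup>2 / (2 * (1 / sqrt h)\<^sup>2)"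
      using h by (simp add: a power2_eq_square field_simps)
    then have "exp (- x\<^sup>2 / 2) * exp (- (a * x\<^sup>2 + c * x))
        = exp (c\<^sup>2 / (2 * h)) * exp (- (x - (- c / h))\<^sup>2 / (2 * (1 / sqrt h)\<^sup>2))"
      by (simp add: exp_add[symmetric] del: power_divide)
    then show ?thesis
      using h by (simp add: normal_density_def K_def real_sqrt_divide field_simps)
  qed
  have "(\<integral>\<^sup>+x. ennreal (normal_density (- c / h) (1 / sqrt h) x) \<partial>lborel) = 1"
    using h by (simp add: nn_integral_eq_integral normal_density_nonneg)
  then have "(\<integral>\<^sup>+x. ennreal (K * normal_density (- c / h) (1 / sqrt h) x) \<partial>lborel) = ennreal K"
    using K by (simp add: ennreal_mult' nn_integral_cmult)
  then show ?thesis
    unfolding eq K_def h_def .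
qed

text \<open>The difference \<open>g\<close> of the two sides has derivative
  \<open>x * (1 + x - \<delta>) / (\<delta> * (1 + x))\<close>, which has the sign of
  \<open>x\<close> or vanishes as long as \<open>1 + x \<ge> \<delta>\<close>. So \<open>g\<close>
  is minimal at 0, where it vanishes.\<close>

lemma ln_one_plus_ge_quadratic:
  fixes w \<delta> :: real
  assumes "0 < \<delta>" "\<delta> \<le> 1" "\<delta> \<le> 1 + w"
  shows "w - w\<^sup>2 / (2 * \<delta>) \<le> ln (1 + w)"
proof -
  define g where "g x = ln (1 + x) - x + x\<^sup>2 / (2 * \<delta>)" for x :: real
  define g' where "g' x = x * (1 + x - \<delta>) / (\<delta> * (1 + x))" for x :: real
  have der: "(g has_real_derivative g' x) (at x)" if "\<delta> \<le> 1 + x" for x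
  proof -
    have x: "0 < 1 + x" using assms that by simp
    have "(g has_real_derivative 1 / (1 + x) - 1 + 2 * x / (2 * \<delta>)) (at x)"
      unfolding g_def using x assms(1) by (auto intro!: derivative_eq_intros)
    also have "1 / (1 + x) - 1 + 2 * x / (2 * \<delta>) = g' x"
      using x assms(1) by (simp add: g'_def field_simps)
    finally show ?thesis .
  qed
  have "g 0 \<le> g w"
  proof (cases "0 \<le> w")
    case True
    show ?thesis
    proof (rule DERIV_nonneg_imp_nondecreasing[OF True])
      fix x assume "0 \<le> x" "x \<le> w"
      then show "\<exists>y. (g has_real_derivative y) (at x) \<and> 0 \<le> y"
        using assms by (intro exI[of _ "g' x"] conjI der) (auto simp: g'_def)
    qed
  next
    case False
    show ?thesis
    proof (rule DERIV_nonpos_imp_nonincreasing[of w 0 g])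
      fix x assume "w \<le> x" "x \<le> 0"
      then show "\<exists>y. (g has_real_derivative y) (at x) \<and> y \<le> 0"
        using assms by (intro exI[of _ "g' x"] conjI der)
          (auto simp: g'_def intro!: divide_nonpos_nonneg mult_nonpos_nonneg)
    qed (use False in auto)
  qed
  then show ?thesis by (simp add: g_def)
qed

text \<open>The square root is written as an exponential and the logarithm estimated at
  \<open>w = 2 * a\<close>. The new exponent is a sum of \<open>a\<close>, \<open>a\<^sup>2\<close>
  and \<open>c\<^sup>2\<close> terms, so the product over the coordinates will involve only a trace
  and two norms.\<close>

lemma exp_div_sqrt_le:
  fixes a c \<delta> :: real
  assumes "0 < \<delta>" "\<delta> \<le> 1" "\<delta> \<le> 1 + 2 * a"
  shows "exp (c\<^sup>2 / (2 * (1 + 2 * a))) / sqrt (1 + 2 * a) \<le> exp (- a + (a\<^sup>2 + c\<^sup>2 / 2) / \<delta>)"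
proof -
  have h: "0 < 1 + 2 * a" using assms by simp
  have "sqrt (1 + 2 * a) = exp (ln (1 + 2 * a) / 2)"
    using h by (simp add: ln_sqrt[symmetric])
  then have "exp (c\<^sup>2 / (2 * (1 + 2 * a))) / sqrt (1 + 2 * a)
      = exp (c\<^sup>2 / (2 * (1 + 2 * a)) - ln (1 + 2 * a) / 2)"
    by (simp add: exp_diff)
  moreover have "2 * a - 2 * a\<^sup>2 / \<delta> \<le> ln (1 + 2 * a)"
    using ln_one_plus_ge_quadratic[of \<delta> "2 * a"] assms by (simp add: power_mult_distrib)
  moreover have "c\<^sup>2 / (2 * (1 + 2 * a)) \<le> c\<^sup>2 / (2 * \<delta>)"
    using assms by (intro divide_left_mono) auto
  ultimately show ?thesis by (simp add: add_divide_distrib)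
qed

section \<open>Laplace transform of the Gaussian quadratic form\<close>

text \<open>As a trace, the squared norm is visibly invariant under orthogonal conjugation; this
  yields the sum of the squared eigenvalues.\<close>

lemma norm_symmetric_mat_sq:
  fixes W :: "real^'n^'n"
  assumes "symmetric_mat W"
  shows "(norm W)\<^sup>2 = trace (W ** W)"
proof -
  have "W $ j $ i = W $ i $ j" for i j
    using assms by (simp add: symmetric_mat_def transpose_def vec_eq_iff)
  then show ?thesis
    by (simp add: norm_vec_def L2_set_def sum_nonneg trace_def matrix_matrix_mult_def power2_eq_square)
qed

text \<open>Hypothesis \<open>bd\<close> says that every eigenvalue \<open>d i\<close> of
  \<open>W\<close> satisfies \<open>1 + 2 * d i \<ge> \<delta>\<close>, which makes each
  one-dimensional integral finite and controlled by the estimate above.\<close>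

lemma std_gaussian_exp_quadratic_le:
  fixes W :: "real^'n^'n" and c :: "real^'n"
  assumes sym: "symmetric_mat W"
    and bd: "\<And>x. (\<delta> - 1) / 2 * (x \<bullet> x) \<le> x \<bullet> (W *v x)"
    and \<delta>: "0 < \<delta>" "\<delta> \<le> 1"
  shows "(\<integral>\<^sup>+x. ennreal (std_gaussian_density x * exp (- (x \<bullet> (W *v x) + c \<bullet> x))) \<partial>lborel)
    \<le> ennreal (exp (- trace W + ((norm W)\<^sup>2 + (norm c)\<^sup>2 / 2) / \<delta>))"
proof -
  obtain U :: "real^'n^'n" and d where U: "orthogonal_matrix U"
    and WU: "W ** U = U ** (\<chi> i j. if i = j then d i else 0)"
    by (rule symmetric_mat_orthogonal_diagonalization[OF sym])
  define D :: "real^'n^'n" where "D = (\<chi> i j. if i = j then d i else 0)"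
  note WU = WU[folded D_def]
  have UU: "transpose U ** U = mat 1" "U ** transpose U = mat 1"
    using U by (auto simp: orthogonal_matrix_def)
  have orth: "orthogonal_transformation ((*v) V)" if "orthogonal_matrix V" for V :: "real^'n^'n"
    using that by (simp add: orthogonal_transformation_matrix)
  have W: "W = U ** D ** transpose U"
    by (simp add: WU[symmetric] matrix_mul_assoc[symmetric] UU)
  define e where "e = transpose U *v c"
  have D: "D *v x = (\<chi> i. d i * x $ i)" for x
    by (simp add: D_def matrix_vector_mult_def vec_eq_iff if_distrib[of "\<lambda>a. a * _"] cong: if_cong)
  have quad: "(U *v x) \<bullet> (W *v (U *v x)) = (\<Sum>i\<in>UNIV. d i * (x $ i)\<^sup>2)" for x
  proof -
    have "W *v (U *v x) = U *v (D *v x)"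
      by (simp add: matrix_vector_mul_assoc WU)
    then have "(U *v x) \<bullet> (W *v (U *v x)) = x \<bullet> (D *v x)"
      using orth[OF U] by (simp add: orthogonal_transformation_def)
    then show ?thesis
      by (simp add: D inner_vec_def power2_eq_square mult_ac)
  qed
  have lin: "c \<bullet> (U *v x) = (\<Sum>i\<in>UNIV. e $ i * x $ i)" for x
  proof -
    have "c \<bullet> (U *v x) = e \<bullet> x"
      by (simp add: e_def dot_lmul_matrix)
    then show ?thesis by (simp add: inner_vec_def)
  qed
  \<comment> \<open>The form is evaluated at the \<open>i\<close>-th column of \<open>U\<close>, a
    unit eigenvector with eigenvalue \<open>d i\<close>.\<close>
  have d: "\<delta> \<le> 1 + 2 * d i" for i
  proof -
    have "(\<delta> - 1) / 2 * ((U *v axis i 1) \<bullet> (U *v axis i 1)) \<le> (\<Sum>j\<in>UNIV. d j * (axis i 1 $ j)\<^sup>2)"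
      using bd[of "U *v axis i 1"] unfolding quad .
    moreover have "(U *v axis i 1) \<bullet> (U *v axis i 1) = 1"
      using orth[OF U] by (simp add: orthogonal_transformation_def inner_axis_axis)
    moreover have "(\<Sum>j\<in>UNIV. d j * (axis i 1 $ j)\<^sup>2) = d i"
      by (simp add: axis_def if_distrib[of "\<lambda>a. a\<^sup>2"] if_distrib[of "\<lambda>a. _ * a"] cong: if_cong)
    ultimately show ?thesis by simp
  qed
  have trW: "trace W = (\<Sum>i\<in>UNIV. d i)"
  proof -
    have "trace W = trace D"
      unfolding W by (subst trace_mul_sym) (simp add: matrix_mul_assoc UU)
    then show ?thesis by (simp add: trace_def D_def)
  qed
  have nW: "(norm W)\<^sup>2 = (\<Sum>i\<in>UNIV. (d i)\<^sup>2)"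
  proof -
    have "W ** W = W ** U ** (D ** transpose U)"
      by (subst (2) W) (simp add: matrix_mul_assoc)
    also have "\<dots> = U ** (D ** D) ** transpose U"
      by (simp add: WU matrix_mul_assoc)
    finally have "trace (W ** W) = trace (U ** (D ** D) ** transpose U)" by simp
    also have "\<dots> = trace (D ** D)"
      by (subst trace_mul_sym) (simp add: matrix_mul_assoc UU)
    also have "\<dots> = (\<Sum>i\<in>UNIV. (d i)\<^sup>2)"
      by (simp add: trace_def matrix_matrix_mult_def D_def power2_eq_square if_distrib[of "\<lambda>a. a * _"] if_distrib[of "\<lambda>a. _ * a"] cong: if_cong)
    finally show ?thesis by (simp add: norm_symmetric_mat_sq[OF sym])
  qed
  have nc: "(norm c)\<^sup>2 = (\<Sum>i\<in>UNIV. (e $ i)\<^sup>2)"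
  proof -
    have "norm e = norm c"
      unfolding e_def using U by (intro orthogonal_transformation_norm orth) simp
    then have "(norm c)\<^sup>2 = (norm e)\<^sup>2" by simp
    then show ?thesis by (simp add: norm_vec_def L2_set_def sum_nonneg)
  qed
  let ?F = "\<lambda>x. ennreal (std_gaussian_density x * exp (- (x \<bullet> (W *v x) + c \<bullet> x)))"
  let ?g = "\<lambda>i x. ennreal (std_normal_density x * exp (- (d i * x\<^sup>2 + e $ i * x)))"
  have "continuous_on UNIV (\<lambda>x. std_gaussian_density x * exp (- (x \<bullet> (W *v x) + c \<bullet> x)))"
    unfolding std_gaussian_density_def by (intro continuous_intros) auto
  then have "?F \<in> borel_measurable borel"
    by (intro measurable_compose[OF _ measurable_ennreal] borel_measurable_continuous_onI)
  then have "(\<integral>\<^sup>+x. ?F x \<partial>lborel) = (\<integral>\<^sup>+x. ?F (U *v x) \<partial>lborel)"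
    using nn_integral_lborel_orthogonal_transformation[OF orth[OF U], of ?F] by simp
  \<comment> \<open>The Gaussian density depends only on the norm, which \<open>U\<close> preserves,
    and in the rotated coordinates the exponent has no mixed terms.\<close>
  also have "\<dots> = (\<integral>\<^sup>+x. (\<Prod>i\<in>UNIV. ?g i (x $ i)) \<partial>lborel)"
  proof (rule nn_integral_cong)
    fix x :: "real^'n"
    have "std_gaussian_density (U *v x) = std_gaussian_density x"
      using orth[OF U] by (simp add: std_gaussian_density_def orthogonal_transformation_norm)
    moreover have "- (\<Sum>i\<in>UNIV. d i * (x $ i)\<^sup>2) - (\<Sum>i\<in>UNIV. e $ i * x $ i)
        = (\<Sum>i\<in>UNIV. - (d i * (x $ i)\<^sup>2 + e $ i * x $ i))"
      by (simp add: sum_negf sum.distrib sum_subtractf)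
    ultimately show "?F (U *v x) = (\<Prod>i\<in>UNIV. ?g i (x $ i))"
      unfolding quad lin
      by (simp add: std_gaussian_density_eq_prod exp_sum prod.distrib[symmetric] prod_ennreal normal_density_nonneg)
  qed
  also have "\<dots> = (\<Prod>i\<in>UNIV. \<integral>\<^sup>+x. ?g i x \<partial>lborel)"
    by (rule nn_integral_lborel_vec_prod) simp
  also have "\<dots> = (\<Prod>i\<in>UNIV. ennreal (exp ((e $ i)\<^sup>2 / (2 * (1 + 2 * d i))) / sqrt (1 + 2 * d i)))"
    using d \<delta> by (intro prod.cong refl nn_integral_std_normal_exp_quadratic) (meson less_le_trans)
  also have "\<dots> = ennreal (\<Prod>i\<in>UNIV. exp ((e $ i)\<^sup>2 / (2 * (1 + 2 * d i))) / sqrt (1 + 2 * d i))"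
    using less_le_trans[OF \<delta>(1) d] by (intro prod_ennreal) (simp add: less_imp_le)
  also have "\<dots> \<le> ennreal (\<Prod>i\<in>UNIV. exp (- d i + ((d i)\<^sup>2 + (e $ i)\<^sup>2 / 2) / \<delta>))"
    using d \<delta> less_le_trans[OF \<delta>(1) d]
    by (intro ennreal_leI prod_mono conjI exp_div_sqrt_le) (auto simp: less_imp_le)
  also have "(\<Prod>i\<in>UNIV. exp (- d i + ((d i)\<^sup>2 + (e $ i)\<^sup>2 / 2) / \<delta>))
      = exp (\<Sum>i\<in>UNIV. - d i + ((d i)\<^sup>2 + (e $ i)\<^sup>2 / 2) / \<delta>)"
    by (simp add: exp_sum)
  also have "(\<Sum>i\<in>UNIV. - d i + ((d i)\<^sup>2 + (e $ i)\<^sup>2 / 2) / \<delta>)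
      = - trace W + ((norm W)\<^sup>2 + (norm c)\<^sup>2 / 2) / \<delta>"
    by (simp add: trW nW nc sum.distrib sum_subtractf sum_divide_distrib add_divide_distrib)
  finally show ?thesis .
qed

section \<open>Lower tail bound by Chernoff's method\<close>

lemma std_gaussian_vector_quadratic_lower_tail:
  fixes Q :: "real^'n^'n" and b :: "real^'n"
  assumes P: "prob_space P" and \<xi>: "std_gaussian_vector P \<xi>"
    and sym: "symmetric_mat Q"
    and bd: "\<And>x. - y * (x \<bullet> x) \<le> x \<bullet> (Q *v x)"
    and y: "0 \<le> y" and z: "0 < z" "(norm Q)\<^sup>2 + (norm b)\<^sup>2 / 2 \<le> z\<^sup>2" and s: "0 < s"
  shows "\<P>(\<omega> in P. \<xi> \<omega> \<bullet> (Q *v \<xi> \<omega>) + b \<bullet> \<xi> \<omega> \<le> trace Q - 2 * z * sqrt s - 2 * y * s) \<le> exp (- s)"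
proof -
  interpret prob_space P by fact
  define r where "r = sqrt s"
  have r: "0 < r" "s = r\<^sup>2" using s by (auto simp: r_def)
  define k where "k = z + 2 * y * r"
  have k: "0 < k" "z \<le> k" using r y z by (auto simp: k_def add_pos_nonneg)
  \<comment> \<open>With this \<open>t\<close>, the Chernoff exponent \<open>t\<^sup>2 * z\<^sup>2 / (1 - 2 * t * y) - t * (2 * z * r + 2 * y * s)\<close>
    equals \<open>- s\<close>; the denominator is \<open>\<delta> = 1 - 2 * t * y\<close>.\<close>
  define t where "t = r / k"
  define \<delta> where "\<delta> = z / k"
  have t: "0 < t" using r k by (simp add: t_def)
  have \<delta>: "0 < \<delta>" "\<delta> \<le> 1" using k z by (auto simp: \<delta>_def)
  \<comment> \<open>This identity makes the eigenvalue bound \<open>- y\<close> for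
    \<open>Q\<close>, scaled by \<open>t\<close>, exactly the hypothesis on
    \<open>t *\<^sub>R Q\<close> in the Laplace bound.\<close>
  have \<delta>t: "(\<delta> - 1) / 2 = - t * y"
  proof -
    have "z = k - 2 * y * r" by (simp add: k_def)
    then show ?thesis using k(1) by (simp add: \<delta>_def t_def diff_divide_distrib)
  qed
  define X where "X = (\<lambda>x. x \<bullet> (Q *v x) + b \<bullet> x)"
  define \<tau> where "\<tau> = trace Q - 2 * z * r - 2 * y * s"
  have [measurable]: "X \<in> borel_measurable borel"
    unfolding X_def by (intro borel_measurable_continuous_onI continuous_intros)
  have dist: "distributed P lborel \<xi> (\<lambda>x. ennreal (std_gaussian_density x))"
    using \<xi> by (simp add: std_gaussian_vector_def)
  have [measurable]: "\<xi> \<in> borel_measurable P"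
    using distributed_measurable[OF dist] by simp
  have W: "symmetric_mat (t *\<^sub>R Q)"
    using sym by (simp add: symmetric_mat_def transpose_def vec_eq_iff)
  have Wb: "(\<delta> - 1) / 2 * (x \<bullet> x) \<le> x \<bullet> ((t *\<^sub>R Q) *v x)" for x
    using mult_left_mono[OF bd[of x], of t] t
    by (simp add: \<delta>t scaleR_matrix_vector_assoc[symmetric] mult_ac)
  have "emeasure P {\<omega>\<in>space P. X (\<xi> \<omega>) \<le> \<tau>}
      \<le> ennreal (exp (t * \<tau>)) * (\<integral>\<^sup>+\<omega>. ennreal (exp (- t * X (\<xi> \<omega>))) * indicator (space P) \<omega> \<partial>P)"
    by (rule Chernoff_ineq_nn_integral_le[OF t]) auto
  also have "(\<integral>\<^sup>+\<omega>. ennreal (exp (- t * X (\<xi> \<omega>))) * indicator (space P) \<omega> \<partial>P)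
      = (\<integral>\<^sup>+\<omega>. ennreal (exp (- t * X (\<xi> \<omega>))) \<partial>P)"
    by (intro nn_integral_cong) simp
  also have "\<dots> = (\<integral>\<^sup>+x. ennreal (std_gaussian_density x) * ennreal (exp (- t * X x)) \<partial>lborel)"
    by (rule distributed_nn_integral[OF dist, symmetric]) simp
  also have "\<dots> = (\<integral>\<^sup>+x. ennreal (std_gaussian_density x
      * exp (- (x \<bullet> ((t *\<^sub>R Q) *v x) + (t *\<^sub>R b) \<bullet> x))) \<partial>lborel)"
  proof (rule nn_integral_cong)
    fix x :: "real^'n"
    have "0 \<le> std_gaussian_density x"
      by (simp add: std_gaussian_density_def)
    moreover have "- t * X x = - (x \<bullet> ((t *\<^sub>R Q) *v x) + (t *\<^sub>R b) \<bullet> x)"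
      by (simp add: X_def scaleR_matrix_vector_assoc[symmetric] distrib_left)
    ultimately show "ennreal (std_gaussian_density x) * ennreal (exp (- t * X x))
        = ennreal (std_gaussian_density x * exp (- (x \<bullet> ((t *\<^sub>R Q) *v x) + (t *\<^sub>R b) \<bullet> x)))"
      by (simp only: ennreal_mult')
  qed
  also have "\<dots> \<le> ennreal (exp (- trace (t *\<^sub>R Q) + ((norm (t *\<^sub>R Q))\<^sup>2 + (norm (t *\<^sub>R b))\<^sup>2 / 2) / \<delta>))"
    by (rule std_gaussian_exp_quadratic_le[OF W Wb \<delta>])
  also have "trace (t *\<^sub>R Q) = t * trace Q"
    by (simp add: trace_def sum_distrib_left)
  also have "((norm (t *\<^sub>R Q))\<^sup>2 + (norm (t *\<^sub>R b))\<^sup>2 / 2) / \<delta> = t\<^sup>2 * ((norm Q)\<^sup>2 + (norm b)\<^sup>2 / 2) / \<delta>"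
    by (simp add: power_mult_distrib algebra_simps)
  also have "ennreal (exp (t * \<tau>)) * ennreal (exp (- (t * trace Q) + t\<^sup>2 * ((norm Q)\<^sup>2 + (norm b)\<^sup>2 / 2) / \<delta>))
      \<le> ennreal (exp (- s))"
  proof -
    have "t\<^sup>2 * ((norm Q)\<^sup>2 + (norm b)\<^sup>2 / 2) / \<delta> \<le> t\<^sup>2 * z\<^sup>2 / \<delta>"
      using \<delta> z by (intro divide_right_mono mult_left_mono) auto
    moreover have "t\<^sup>2 * z\<^sup>2 / \<delta> - t * (2 * z * r + 2 * y * s) = - s"
    proof -
      have "t\<^sup>2 * z\<^sup>2 / \<delta> = r\<^sup>2 * z / k"
        using k z by (simp add: t_def \<delta>_def field_simps power2_eq_square)
      moreover have "t * (2 * z * r + 2 * y * s) = r\<^sup>2 + r\<^sup>2 * z / k"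
      proof -
        \<comment> \<open>By definition of \<open>k\<close>,
          \<open>2 * y * s = r * (2 * y * r) = r * (k - z)\<close>.\<close>
        have eq: "2 * z * r + 2 * y * s = r * (k + z)"
          by (simp add: r k_def algebra_simps power2_eq_square)
        show ?thesis
          unfolding eq using k(1) by (simp add: t_def algebra_simps power2_eq_square add_divide_distrib)
      qed
      ultimately show ?thesis
        by (simp add: r)
    qed
    ultimately have "t * \<tau> + (- (t * trace Q) + t\<^sup>2 * ((norm Q)\<^sup>2 + (norm b)\<^sup>2 / 2) / \<delta>) \<le> - s"
      by (simp add: \<tau>_def algebra_simps)
    then show ?thesis
      by (simp add: ennreal_mult'[symmetric] exp_add[symmetric] ennreal_leI)
  qed
  finally show ?thesis
    by (simp add: emeasure_eq_measure X_def \<tau>_def r_def mult_left_mono)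
qed

section \<open>Reduction to the tail bound through the complementary event\<close>

theorem lemma2:
  fixes \<sigma> \<gamma> \<rho> y z :: real
    and A B Q :: "real^'n^'n"
    and M :: "complex^'n^'n"
    and b :: "real^'n"
    and P :: "'a measure"
    and \<xi> :: "'a \<Rightarrow> real^'n"
  assumes "\<sigma> > 0" and "\<gamma> > 0" and "0 < \<rho>" and "\<rho> < 1"
    and "symmetric_mat A" and "symmetric_mat Q" and "skew_symmetric_mat B"
    and "(\<Sum>k\<in>UNIV. \<Sum>l\<in>UNIV. A $ k $ l) + trace Q - 2 * z * sqrt (ln (inverse \<rho>)) + 2 * y * ln \<rho> \<ge> \<gamma>"
    and "sqrt ((frobenius_norm Q)\<^sup>2 + 1 / 2 * (norm b)\<^sup>2) \<le> z"
    and "pos_semidef (y *\<^sub>R mat 1 + Q)"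
    and "Q = \<sigma>\<^sup>2 *\<^sub>R L_map A"
    and "b = \<sigma> *\<^sub>R f_map B"
    and "y \<ge> 0"
    and "M = complex_mat A B"
    and "prob_space P"
    and "std_gaussian_vector P \<xi>"
  shows "\<P>(\<omega> in P. Re (\<Sum>k\<in>UNIV. \<Sum>l\<in>UNIV. M $ k $ l)
            + \<sigma>\<^sup>2 * (\<xi> \<omega> \<bullet> (L_map A *v \<xi> \<omega>)) + \<sigma> * (f_map B \<bullet> \<xi> \<omega>) \<ge> \<gamma>)
         \<ge> 1 - \<rho>"
proof -
  interpret prob_space P by fact
  define s where "s = ln (inverse \<rho>)"
  have s: "0 < s" "ln \<rho> = - s" "exp (- s) = \<rho>"
    using assms(3,4) by (auto simp: s_def ln_inverse)
  define a where "a = (\<Sum>k\<in>UNIV. \<Sum>l\<in>UNIV. A $ k $ l)"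
  have Re: "Re (\<Sum>k\<in>UNIV. \<Sum>l\<in>UNIV. M $ k $ l) = a"
    using sum_complex_mat_real[OF assms(7), of A] assms(14) by (simp add: a_def)
  define X where "X = (\<lambda>x. x \<bullet> (Q *v x) + b \<bullet> x)"
  have X: "a + \<sigma>\<^sup>2 * (x \<bullet> (L_map A *v x)) + \<sigma> * (f_map B \<bullet> x) = a + X x" for x
    by (simp add: X_def assms(11,12) scaleR_matrix_vector_assoc[symmetric])
  have \<gamma>: "\<gamma> \<le> a + trace Q - 2 * z * sqrt s - 2 * y * s"
    using assms(8) s by (simp add: a_def s_def)
  have nn: "0 \<le> (norm Q)\<^sup>2 + (norm b)\<^sup>2 / 2" by simp
  have z: "0 \<le> z" "(norm Q)\<^sup>2 + (norm b)\<^sup>2 / 2 \<le> z\<^sup>2"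
    using assms(9) by (auto simp: frobenius_norm_eq_norm sqrt_le_D intro: order_trans[OF real_sqrt_ge_zero[OF nn]])
  have bd: "- y * (x \<bullet> x) \<le> x \<bullet> (Q *v x)" for x
  proof -
    have "0 \<le> x \<bullet> ((y *\<^sub>R mat 1 + Q) *v x)"
      using assms(10) by (simp add: pos_semidef_def)
    also have "\<dots> = y * (x \<bullet> x) + x \<bullet> (Q *v x)"
      by (simp add: matrix_vector_mult_add_rdistrib scaleR_matrix_vector_assoc[symmetric] inner_add_right)
    finally show ?thesis by simp
  qed
  have [measurable]: "\<xi> \<in> borel_measurable P"
    using distributed_measurable[of P lborel \<xi>] assms(16) by (simp add: std_gaussian_vector_def)
  have [measurable]: "X \<in> borel_measurable borel"
    unfolding X_def by (intro borel_measurable_continuous_onI continuous_intros)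
  have "\<P>(\<omega> in P. a + X (\<xi> \<omega>) < \<gamma>) \<le> \<rho>"
  \<comment> \<open>The tail bound requires \<open>0 < z\<close>. If \<open>z = 0\<close>, the norm
    constraint forces \<open>Q = 0\<close> and \<open>b = 0\<close>, so \<open>X\<close> vanishes,
    \<open>\<gamma> \<le> a - 2 * y * s \<le> a\<close>, and the failure event is empty.\<close>
  proof (cases "z = 0")
    case True
    then have "(norm Q)\<^sup>2 + (norm b)\<^sup>2 / 2 \<le> 0"
      using z(2) by simp
    then have "(norm Q)\<^sup>2 = 0" "(norm b)\<^sup>2 = 0"
      using zero_le_power2[of "norm Q"] zero_le_power2[of "norm b"] by linarith+
    then have "Q = 0" "b = 0" by auto
    moreover have "0 \<le> y * s" using s(1) assms(13) by simp
    ultimately have "\<gamma> \<le> a + X x" for x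
      using \<gamma> True by (simp add: X_def trace_def del: zero_le_mult_iff mult_nonneg_nonneg)
    then have empty: "{\<omega> \<in> space P. a + X (\<xi> \<omega>) < \<gamma>} = {}" by (auto simp: not_less)
    show ?thesis unfolding empty using assms(3) by simp
  next
    case False
    \<comment> \<open>By the feasibility inequality, \<open>\<gamma> - a\<close> is at most the
      threshold of the tail bound.\<close>
    have "\<P>(\<omega> in P. a + X (\<xi> \<omega>) < \<gamma>) \<le> \<P>(\<omega> in P. X (\<xi> \<omega>) \<le> trace Q - 2 * z * sqrt s - 2 * y * s)"
      using \<gamma> by (intro finite_measure_mono) auto
    also have "\<dots> \<le> \<rho>"
      using std_gaussian_vector_quadratic_lower_tail[OF assms(15,16,6) bd assms(13) _ z(2) s(1)] z(1) False
      by (simp add: X_def s(3))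
    finally show ?thesis .
  qed
  moreover have "\<P>(\<omega> in P. \<not> (\<gamma> \<le> a + X (\<xi> \<omega>))) = 1 - \<P>(\<omega> in P. \<gamma> \<le> a + X (\<xi> \<omega>))"
    by (rule prob_neg) measurable
  ultimately show ?thesis
    unfolding Re X by (simp add: not_le)
qed

end
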